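(* Let $a,b$ be coprime positive integers, let $n\ge 0$ be an integer and let $x$ be a variable. Then $$\sum_{i=1}^{b-1}\sum_{j=1}^{a-1}\left(\frac{x}{ab}+\frac{j}{a}+\frac{i}{b}\right)^n=\frac{x^n}{(ab)^n}-\frac{B_{n+1}\left(\frac{x}{a}+b\right)-B_{n+1}\left(\frac{x}{a}\right)}{b^n(n+1)}-\frac{B_{n+1}\left(\frac{x}{b}+a\right)-B_{n+1}\left(\frac{x}{b}\right)}{a^n(n+1)}$$ $$+\frac{B_{n+1}(x+ab)-B_{n+1}(x)}{(ab)^n(n+1)}+\frac{1}{(ab)^n}\sum_{i=0}^n\binom{n}{i}\left((x+ab)^{n-i}-x^{n-i}\right)S_{a,b}(i).$$ In particular, for $x=0$, $$\sum_{i=1}^{b-1}\sum_{j=1}^{a-1}\left(\frac{j}{a}+\frac{i}{b}\right)^n=\sum_{i=0}^{n}\binom{n}{i}\frac{S_{a,b}(i)}{(ab)^i}+\frac{1}{n+1}\left(\frac{B_{n+1}(ab)}{(ab)^n}-\frac{B_{n+1}(a)}{a^n}-\frac{B_{n+1}(b)}{b^n}-B_{n+1}\cdot\left(\frac{1}{(ab)^n}-\frac{1}{a^n}-\frac{1}{b^n}\right)\right),$$ where in the last term $B_{n+1}$ is the Bernoulli number multiplied by the expression in parentheses.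
   Context: For coprime positive integers $a,b$, $S_{a,b}=\{ua+vb:\ u,v\in\mathbb{Z}_{\ge 0}\}$ is the numerical semigroup generated by $a,b$, and $C_{a,b}:=\mathbb{Z}_{\ge 0}\setminus S_{a,b}$ is its (finite) complement. The Sylvester sums are $S_{a,b}(m):=\sum_{k\in C_{a,b}}k^m$. The Bernoulli polynomials are $B_n(x)=\sum_{i=0}^n\binom{n}{i}B_ix^{n-i}$ with Bernoulli numbers $B_n=B_n(0)$.
   Formalization: The x=0 formula is false as printed (a=2, b=3, n=1: left side 2, right side 13/6); it is proved with the Sylvester sum running over 0≤i≤n−1 instead of 0≤i≤n and with an added term 0^n (1 if n=0, else 0). *)

theory Defs
  imports "HOL-Number_Theory.Cong" "HOL-Computational_Algebra.Formal_Power_Series"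
begin

definition numsemigroup :: "nat \<Rightarrow> nat \<Rightarrow> nat set" where
  "numsemigroup a b = {u * a + v * b | u v :: nat. True}"

definition gaps :: "nat \<Rightarrow> nat \<Rightarrow> nat set" where
  "gaps a b = UNIV - numsemigroup a b"

definition sylvester_sum :: "nat \<Rightarrow> nat \<Rightarrow> nat \<Rightarrow> nat" where
  "sylvester_sum a b m = (\<Sum>k\<in>gaps a b. k ^ m)"

(* Exponential generating function t / (exp t - 1), i.e. the convention B_1 = -1/2. *)
definition bernoulli :: "nat \<Rightarrow> rat" where
  "bernoulli n = fact n * fps_nth (fps_X / (fps_exp 1 - 1)) n"

definition bernpoly :: "nat \<Rightarrow> 'a :: field_char_0 \<Rightarrow> 'a" where
  "bernpoly n x = (\<Sum>i=0..n. of_nat (n choose i) * of_rat (bernoulli i) * x ^ (n - i))"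

lemma bernpoly_0_right: "bernpoly n (0 :: 'a :: field_char_0) = of_rat (bernoulli n)"
proof -
  have "bernpoly n (0 :: 'a) = (\<Sum>i\<in>{0..n}. if i = n then of_rat (bernoulli n) else 0)"
    unfolding bernpoly_def by (intro sum.cong) (auto simp: power_0_left)
  then show ?thesis by simp
qed

lemma bernoulli_egf:
  "Abs_fps (\<lambda>n. bernoulli n / fact n) * (fps_exp 1 - 1) = fps_X"
proof -
  have nz: "fps_nth (fps_exp 1 - 1 :: rat fps) 1 \<noteq> 0" by simp
  have sd: "subdegree (fps_exp 1 - 1 :: rat fps) = 1"
    by (rule subdegreeI) auto
  have dvd: "(fps_exp 1 - 1 :: rat fps) dvd fps_X"
    using sd nz by (subst fps_dvd_iff) auto
  have "Abs_fps (\<lambda>n. bernoulli n / fact n) = fps_X / (fps_exp 1 - 1)"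
    by (simp add: fps_eq_iff bernoulli_def)
  then show ?thesis using dvd by simp
qed

lemma bernoulli_recurrence:
  "(\<Sum>k=0..n. of_nat (Suc n choose k) * bernoulli k) = (if n = 0 then 1 else 0)"
proof -
  have "fps_nth (Abs_fps (\<lambda>n. bernoulli n / fact n) * (fps_exp 1 - 1)) (Suc n) =
        (\<Sum>k=0..n. bernoulli k / fact k * (1 / fact (Suc n - k)))"
    by (simp add: fps_mult_nth Suc_diff_le) (simp add: mult_ac)
  also have "\<dots> = (\<Sum>k=0..n. of_nat (Suc n choose k) * bernoulli k) / fact (Suc n)"
    unfolding sum_divide_distrib
    by (intro sum.cong refl) (simp add: binomial_fact mult_ac del: fact_Suc)
  finally show ?thesis
    unfolding bernoulli_egf by (auto simp: divide_simps simp del: fact_Suc split: if_splits)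
qed

lemma bernoulli_0: "bernoulli 0 = 1"
  using bernoulli_recurrence[of 0] by simp

lemma bernoulli_1: "bernoulli 1 = - 1 / 2"
  using bernoulli_recurrence[of 1] by (simp add: bernoulli_0)

(* The complement is finite, so sylvester_sum is a genuine sum. *)
lemma finite_gaps:
  assumes "a > 0" "b > 0" "coprime a b"
  shows "finite (gaps a b)"
proof (rule finite_subset)
  show "gaps a b \<subseteq> {..<a * b}"
  proof
    fix k assume k: "k \<in> gaps a b"
    show "k \<in> {..<a * b}"
    proof (rule ccontr)
      assume "k \<notin> {..<a * b}"
      then have ge: "a * b \<le> k" by simp
      obtain y where y: "[a * y = 1] (mod b)"
        using assms cong_solve_coprime_nat[of a b] by auto
      define u where "u = (k * y) mod b"
      have "[a * u = a * (k * y)] (mod b)"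
        unfolding u_def by (intro cong_scalar_left) (simp add: cong_def)
      also have "a * (k * y) = k * (a * y)" by simp
      also have "[k * (a * y) = k * 1] (mod b)"
        using y by (rule cong_scalar_left)
      finally have c: "[a * u = k] (mod b)" by simp
      have "u < b" using assms by (simp add: u_def)
      then have "a * u \<le> k" using ge by (meson le_trans less_imp_le mult_le_mono2)
      with c have "b dvd k - a * u" by (metis cong_altdef_nat cong_sym)
      then obtain v where "k - a * u = b * v" by (rule dvdE)
      with \<open>a * u \<le> k\<close> have "k = u * a + v * b" by (simp add: mult.commute)
      then have "k \<in> numsemigroup a b" by (auto simp: numsemigroup_def)
      with k show False by (simp add: gaps_def)
    qed
  qed
qed simp

end

theory Submission
  imports Defs
begin

text \<open>
  For \<open>0 \<le> i < b\<close> and \<open>0 \<le> j < a\<close> the numbers \<open>ia + jb\<close> represent every residue modulo \<open>ab\<close>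
  exactly once; the representative of \<open>r < ab\<close> is \<open>r\<close> itself if \<open>r\<close> lies in the semigroup, and
  \<open>r + ab\<close> if \<open>r\<close> is a gap. Hence a sum of \<open>F (ia + jb)\<close> over the box is the sum of \<open>F r\<close> over
  \<open>r < ab\<close>, corrected by \<open>F (g + ab) - F g\<close> for each gap \<open>g\<close>. Taking \<open>F k = (x + k)^n\<close> and removing
  the two edges \<open>i = 0\<close> and \<open>j = 0\<close>, the sums over arithmetic progressions become differences of
  Bernoulli polynomials and the binomial theorem turns the correction into Sylvester sums.
\<close>

section \<open>Bernoulli polynomials and power sums\<close>

text \<open>The embedding \<open>of_rat\<close> respects sums and products, so it carries the
  rational identity \<open>bernoulli_egf\<close>, coefficient by coefficient, into the field where
  \<open>x\<close> lives.\<close>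

lemma bernoulli_egf_of_rat:
  "Abs_fps (\<lambda>n. of_rat (bernoulli n) / fact n) * (fps_exp 1 - 1) = (fps_X :: 'a :: field_char_0 fps)"
proof (rule fps_ext)
  fix n
  have fact: "of_rat (fact k) = (fact k :: 'a)" for k
    by (metis of_nat_fact of_rat_of_nat_eq)
  have "fps_nth (Abs_fps (\<lambda>n. of_rat (bernoulli n) / fact n) * (fps_exp 1 - 1)) n =
      (of_rat (fps_nth (Abs_fps (\<lambda>n. bernoulli n / fact n) * (fps_exp 1 - 1)) n) :: 'a)"
    unfolding fps_mult_nth of_rat_sum
    by (intro sum.cong refl) (simp add: of_rat_mult of_rat_divide of_rat_diff fact)
  also have "\<dots> = fps_nth fps_X n"
    by (simp add: bernoulli_egf fps_X_def)
  finally show "fps_nth (Abs_fps (\<lambda>n. of_rat (bernoulli n) / fact n) * (fps_exp 1 - 1)) n =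
      fps_nth (fps_X :: 'a fps) n" .
qed

lemma bernpoly_egf:
  fixes x :: "'a :: field_char_0"
  shows "Abs_fps (\<lambda>n. bernpoly n x / fact n) =
    Abs_fps (\<lambda>n. of_rat (bernoulli n) / fact n) * fps_exp x"
proof (rule fps_ext)
  fix n
  show "fps_nth (Abs_fps (\<lambda>n. bernpoly n x / fact n)) n =
    fps_nth (Abs_fps (\<lambda>n. of_rat (bernoulli n) / fact n) * fps_exp x) n"
    unfolding fps_mult_nth bernpoly_def fps_nth_Abs_fps sum_divide_distrib
    by (intro sum.cong refl) (simp add: binomial_fact field_simps)
qed

text \<open>Shifting \<open>x\<close> by 1 multiplies the generating function B(t) exp(xt) by
  exp(t). Since B(t) (exp(t) - 1) = t, the difference is t exp(xt); compare coefficients at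
  \<open>Suc n\<close>.\<close>

lemma bernpoly_Suc_add_one:
  fixes x :: "'a :: field_char_0"
  shows "bernpoly (Suc n) (x + 1) - bernpoly (Suc n) x = of_nat (Suc n) * x ^ n"
proof -
  let ?B = "Abs_fps (\<lambda>n. of_rat (bernoulli n) / fact n) :: 'a fps"
  have "Abs_fps (\<lambda>n. bernpoly n (x + 1) / fact n) - Abs_fps (\<lambda>n. bernpoly n x / fact n) =
      ?B * (fps_exp 1 - 1) * fps_exp x"
    by (simp add: bernpoly_egf fps_exp_add_mult algebra_simps)
  also have "\<dots> = fps_X * fps_exp x"
    by (simp only: bernoulli_egf_of_rat)
  finally have "fps_nth (Abs_fps (\<lambda>n. bernpoly n (x + 1) / fact n)
      - Abs_fps (\<lambda>n. bernpoly n x / fact n)) (Suc n) = fps_nth (fps_X * fps_exp x) (Suc n)"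
    by simp
  then have "(bernpoly (Suc n) (x + 1) - bernpoly (Suc n) x) / fact (Suc n) = x ^ n / fact n"
    by (simp add: diff_divide_distrib del: fact_Suc)
  then have "bernpoly (Suc n) (x + 1) - bernpoly (Suc n) x = fact (Suc n) * (x ^ n / fact n)"
    by (simp add: field_simps del: fact_Suc)
  then show ?thesis
    by (simp del: of_nat_Suc)
qed

lemma sum_power_eq_bernpoly:
  fixes x :: "'a :: field_char_0"
  shows "(\<Sum>k<m. (x + of_nat k) ^ n) =
    (bernpoly (Suc n) (x + of_nat m) - bernpoly (Suc n) x) / of_nat (Suc n)"
proof (induction m)
  case (Suc m)
  have "bernpoly (Suc n) (x + of_nat (Suc m)) =
      bernpoly (Suc n) (x + of_nat m) + of_nat (Suc n) * (x + of_nat m) ^ n"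
    using bernpoly_Suc_add_one[of n "x + of_nat m"] by (simp add: algebra_simps)
  with Suc show ?case
    by (simp add: add_divide_distrib diff_divide_distrib del: of_nat_Suc)
qed simp

text \<open>Writing x + kd = d (x/d + k) reduces step \<open>d\<close> to step 1.\<close>

lemma sum_power_arith_progression:
  fixes x :: "'a :: field_char_0"
  assumes "d > 0"
  shows "(\<Sum>k<m. (x + of_nat (k * d)) ^ n) = of_nat d ^ n *
    ((bernpoly (Suc n) (x / of_nat d + of_nat m) - bernpoly (Suc n) (x / of_nat d)) / of_nat (Suc n))"
proof -
  have "(x + of_nat (k * d)) ^ n = of_nat d ^ n * (x / of_nat d + of_nat k) ^ n" for k
    using assms by (simp add: field_simps flip: power_mult_distrib)
  then show ?thesis
    by (simp add: sum_power_eq_bernpoly flip: sum_distrib_left)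
qed

section \<open>Residues modulo ab and gaps of the semigroup\<close>

text \<open>Reduction modulo \<open>b\<close> removes \<open>j * b\<close>, and \<open>a\<close> is
  invertible there, so \<open>i\<close> is determined; symmetrically for \<open>j\<close> modulo
  \<open>a\<close>. Surjectivity then follows by counting.\<close>

lemma bij_betw_two_generator_residues:
  fixes a b :: nat
  assumes "coprime a b"
  shows "bij_betw (\<lambda>(i, j). (i * a + j * b) mod (a * b)) ({..<b} \<times> {..<a}) {..<a * b}"
    (is "bij_betw ?f ?A ?B")
proof (cases "a > 0 \<and> b > 0")
  case True
  have inj: "inj_on ?f ?A"
  proof (rule inj_onI, clarsimp)
    fix i j i' j'
    assume lt: "i < b" "j < a" "i' < b" "j' < a"
      and "(i * a + j * b) mod (a * b) = (i' * a + j' * b) mod (a * b)"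
    then have c: "[i * a + j * b = i' * a + j' * b] (mod a * b)"
      by (simp add: cong_def)
    have "[i * a = i' * a] (mod b)"
      using cong_modulus_mult_nat[OF c[unfolded mult.commute[of a b]]]
      by (simp add: cong_def)
    then have "[i = i'] (mod b)"
      using assms by (simp add: cong_mult_rcancel_nat)
    moreover have "[j * b = j' * b] (mod a)"
      using cong_modulus_mult_nat[OF c] by (simp add: cong_def)
    then have "[j = j'] (mod a)"
      using assms by (simp add: cong_mult_rcancel_nat coprime_commute)
    ultimately show "i = i' \<and> j = j'"
      using lt by (simp add: cong_def)
  qed
  moreover have "?f ` ?A = ?B"
  proof (rule card_subset_eq)
    show "?f ` ?A \<subseteq> ?B"
      using True by auto
    show "card (?f ` ?A) = card ?B"
      by (simp add: card_image[OF inj] card_cartesian_product)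
  qed simp
  ultimately show ?thesis
    by (simp add: bij_betw_def)
qed (auto simp: bij_betw_def)

text \<open>Ensures that a box value exceeds its residue modulo \<open>a * b\<close> by either 0 or
  exactly \<open>a * b\<close>.\<close>

lemma add_less_two_mult:
  fixes a b i j :: nat
  assumes "i < b" "j < a"
  shows "i * a + j * b < 2 * (a * b)"
proof -
  have "i * a < b * a" "j * b < a * b"
    using assms by auto
  then show ?thesis
    unfolding mult.commute[of b a] by linarith
qed

lemma gaps_subset:
  assumes "a > 0" "b > 0" "coprime a b"
  shows "gaps a b \<subseteq> {..<a * b}"
proof (rule subsetI, rule ccontr)
  fix k
  assume k: "k \<in> gaps a b" and "k \<notin> {..<a * b}"
  then have ge: "a * b \<le> k" by simp
  have "k mod (a * b) \<in> (\<lambda>(i, j). (i * a + j * b) mod (a * b)) ` ({..<b} \<times> {..<a})"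
    using bij_betw_two_generator_residues[OF assms(3)] assms by (simp add: bij_betw_def)
  then obtain i j where ij: "i < b" "j < a" and eq: "k mod (a * b) = (i * a + j * b) mod (a * b)"
    by auto
  let ?v = "i * a + j * b"
  \<comment> \<open>Otherwise the congruent number \<open>?v\<close> would be at least k + ab, hence
    at least 2ab, too large for a box value. So \<open>k\<close> is \<open>?v\<close> plus a
    multiple of ab, which can be absorbed into the coefficient of \<open>a\<close>.\<close>
  have "?v \<le> k"
  proof (rule ccontr)
    assume "\<not> ?v \<le> k"
    moreover from this have "a * b dvd ?v - k"
      using eq by (metis mod_eq_dvd_iff_nat nat_le_linear)
    ultimately have "a * b \<le> ?v - k"
      by (intro dvd_imp_le) auto
    with ge add_less_two_mult[OF ij] show False by linarith
  qed
  moreover from this have "a * b dvd k - ?v"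
    using eq by (metis mod_eq_dvd_iff_nat)
  ultimately obtain m where "k = ?v + a * b * m"
    by (metis dvdE le_add_diff_inverse)
  then have "k = (i + b * m) * a + j * b"
    by (simp add: algebra_simps)
  with k show False
    unfolding gaps_def numsemigroup_def by blast
qed

text \<open>If the difference were ua + wb, reduction modulo \<open>b\<close> and \<open>a\<close>
  would give u = i (mod b) and w = j (mod a). As \<open>i\<close> and \<open>j\<close> are least
  residues, u \<ge> i and w \<ge> j, so ua + wb + ab would exceed ia + jb.\<close>

lemma diff_mult_in_gaps:
  assumes "coprime a b" "i < b" "j < a" "a * b \<le> i * a + j * b"
  shows "i * a + j * b - a * b \<in> gaps a b"
proof (rule ccontr)
  assume "i * a + j * b - a * b \<notin> gaps a b"
  then obtain u w where "i * a + j * b - a * b = u * a + w * b"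
    by (auto simp: gaps_def numsemigroup_def)
  with assms(4) have eq: "i * a + j * b = u * a + w * b + a * b"
    by linarith
  have "[i * a = u * a] (mod b)"
    using arg_cong[OF eq, of "\<lambda>v. v mod b"] by (simp add: cong_def)
  then have "[i = u] (mod b)"
    using assms by (simp add: cong_mult_rcancel_nat)
  then have "i \<le> u"
    using assms(2) by (metis cong_def mod_less mod_less_eq_dividend)
  have "[j * b = w * b] (mod a)"
    using arg_cong[OF eq, of "\<lambda>v. v mod a"] by (simp add: cong_def mod_add_eq)
  then have "[j = w] (mod a)"
    using assms by (simp add: cong_mult_rcancel_nat coprime_commute)
  then have "j \<le> w"
    using assms(3) by (metis cong_def mod_less mod_less_eq_dividend)
  have "i * a \<le> u * a" "j * b \<le> w * b"
    using \<open>i \<le> u\<close> \<open>j \<le> w\<close> by simp_all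
  moreover have "a * b > 0"
    using assms by simp
  ultimately show False
    using eq by linarith
qed

lemma sum_box_eq_sum_gaps:
  fixes F :: "nat \<Rightarrow> 'a :: ab_group_add"
  assumes "a > 0" "b > 0" "coprime a b"
  shows "(\<Sum>i<b. \<Sum>j<a. F (i * a + j * b)) =
    (\<Sum>r<a * b. F r) + (\<Sum>g\<in>gaps a b. F (g + a * b) - F g)"
proof -
  \<comment> \<open>\<open>\<psi>\<close> recovers the box value from its residue: a value below ab
    is its own residue and no gap, while a larger one drops by ab to a gap.\<close>
  define \<psi> where "\<psi> r = (if r \<in> gaps a b then r + a * b else r)" for r
  have \<psi>: "\<psi> ((i * a + j * b) mod (a * b)) = i * a + j * b" if ij: "i < b" "j < a" for i j
  proof (cases "i * a + j * b < a * b")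
    case True
    moreover have "i * a + j * b \<notin> gaps a b"
      unfolding gaps_def numsemigroup_def by blast
    ultimately show ?thesis
      by (simp add: \<psi>_def)
  next
    case False
    then have "(i * a + j * b) mod (a * b) = i * a + j * b - a * b"
      using add_less_two_mult[OF ij] by (simp add: le_mod_geq)
    with False show ?thesis
      using diff_mult_in_gaps[OF assms(3) ij] by (simp add: \<psi>_def)
  qed
  have "(\<Sum>i<b. \<Sum>j<a. F (i * a + j * b)) =
      (\<Sum>i<b. \<Sum>j<a. F (\<psi> ((i * a + j * b) mod (a * b))))"
    by (intro sum.cong refl) (simp add: \<psi>)
  also have "\<dots> = (\<Sum>p\<in>{..<b} \<times> {..<a}. F (\<psi> ((\<lambda>(i, j). (i * a + j * b) mod (a * b)) p)))"
    by (simp add: sum.cartesian_product case_prod_unfold)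
  also have "\<dots> = (\<Sum>r<a * b. F (\<psi> r))"
    by (rule sum.reindex_bij_betw[OF bij_betw_two_generator_residues[OF assms(3)]])
  also have "\<dots> = (\<Sum>r<a * b. F r + (if r \<in> gaps a b then F (r + a * b) - F r else 0))"
    by (intro sum.cong refl) (simp add: \<psi>_def)
  also have "\<dots> = (\<Sum>r<a * b. F r) + (\<Sum>g\<in>gaps a b. F (g + a * b) - F g)"
    using gaps_subset[OF assms]
    by (simp add: sum.distrib Int_absorb1 flip: sum.inter_restrict)
  finally show ?thesis .
qed

section \<open>Edges of the box and Sylvester sums\<close>

lemma sum_lessThan_remove_0:
  fixes f :: "nat \<Rightarrow> 'a :: ab_group_add"
  assumes "m > 0"
  shows "sum f {1..m - 1} = sum f {..<m} - f 0"
proof -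
  have "{..<m} = insert 0 {1..m - 1}"
    using assms by auto
  then show ?thesis by simp
qed

text \<open>Inclusion-exclusion: deleting the edges i = 0 and j = 0 removes the corner twice, so
  \<open>F 0\<close> is added back.\<close>

lemma sum_box_interior:
  fixes F :: "nat \<Rightarrow> 'a :: ab_group_add"
  assumes "a > 0" "b > 0"
  shows "(\<Sum>i=1..b-1. \<Sum>j=1..a-1. F (i * a + j * b)) =
    F 0 - (\<Sum>i<b. F (i * a)) - (\<Sum>j<a. F (j * b)) + (\<Sum>i<b. \<Sum>j<a. F (i * a + j * b))"
  unfolding sum_lessThan_remove_0[OF assms(1)] sum_lessThan_remove_0[OF assms(2)]
  by (simp add: sum_subtractf algebra_simps)

text \<open>Expand both powers by the binomial theorem and exchange the sums; the inner sum of
  \<open>g ^ i\<close> over the gaps is a Sylvester sum.\<close>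

lemma sum_gaps_power_eq_sylvester_sums:
  fixes x :: "'a :: field_char_0"
  shows "(\<Sum>g\<in>gaps a b. (x + c + of_nat g) ^ n - (x + of_nat g) ^ n) =
    (\<Sum>i=0..n. of_nat (n choose i) * ((x + c) ^ (n - i) - x ^ (n - i)) * of_nat (sylvester_sum a b i))"
proof -
  have pow: "(y + of_nat g) ^ n =
      (\<Sum>i=0..n. of_nat (n choose i) * y ^ (n - i) * of_nat g ^ i)" for g and y :: 'a
    using binomial_ring[of "of_nat g" y n]
    by (simp add: add.commute atLeast0AtMost mult_ac)
  have "(x + c + of_nat g) ^ n - (x + of_nat g) ^ n =
      (\<Sum>i=0..n. of_nat (n choose i) * ((x + c) ^ (n - i) - x ^ (n - i)) * of_nat g ^ i)" for g
    unfolding pow sum_subtractf[symmetric]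
    by (simp only: right_diff_distrib left_diff_distrib)
  then show ?thesis
    by (simp add: sylvester_sum_def sum_distrib_left sum.swap[of _ "gaps a b"])
qed

section \<open>The two identities\<close>

lemma sum_shifted_box_power:
  fixes x :: "'a :: field_char_0"
  assumes "a > 0" "b > 0" "coprime a b"
  shows
    "(\<Sum>i=1..b-1. \<Sum>j=1..a-1.
        (x / of_nat (a * b) + of_nat j / of_nat a + of_nat i / of_nat b) ^ n)
    = x ^ n / of_nat (a * b) ^ n
      - (bernpoly (n + 1) (x / of_nat a + of_nat b) - bernpoly (n + 1) (x / of_nat a))
          / (of_nat b ^ n * of_nat (n + 1))
      - (bernpoly (n + 1) (x / of_nat b + of_nat a) - bernpoly (n + 1) (x / of_nat b))
          / (of_nat a ^ n * of_nat (n + 1))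
      + (bernpoly (n + 1) (x + of_nat (a * b)) - bernpoly (n + 1) x)
          / (of_nat (a * b) ^ n * of_nat (n + 1))
      + 1 / of_nat (a * b) ^ n *
          (\<Sum>i=0..n. of_nat (n choose i)
             * ((x + of_nat (a * b)) ^ (n - i) - x ^ (n - i))
             * of_nat (sylvester_sum a b i))"
proof -
  define F :: "nat \<Rightarrow> 'a" where "F k = (x + of_nat k) ^ n" for k
  define A B :: 'a where "A = of_nat a" and "B = of_nat b"
  define N :: 'a where "N = of_nat (n + 1)"
  have nz: "A \<noteq> 0" "B \<noteq> 0" "N \<noteq> 0"
    using assms by (simp_all add: A_def B_def N_def del: of_nat_add of_nat_Suc)
  have summand: "(x / of_nat (a * b) + of_nat j / of_nat a + of_nat i / of_nat b) ^ n =
      F (i * a + j * b) / of_nat (a * b) ^ n" for i j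
    unfolding F_def power_divide[symmetric]
    using assms by (intro arg_cong[where f = "\<lambda>t. t ^ n"]) (simp add: field_simps)
  have "F (g + a * b) - F g = (x + of_nat (a * b) + of_nat g) ^ n - (x + of_nat g) ^ n" for g
    by (simp add: F_def algebra_simps)
  then have gaps: "(\<Sum>g\<in>gaps a b. F (g + a * b) - F g) =
      (\<Sum>i=0..n. of_nat (n choose i) * ((x + of_nat (a * b)) ^ (n - i) - x ^ (n - i))
         * of_nat (sylvester_sum a b i))" (is "_ = ?G")
    by (simp only: sum_gaps_power_eq_sylvester_sums)
  have rows: "(\<Sum>i<b. F (i * a)) = A ^ n *
      ((bernpoly (n + 1) (x / of_nat a + of_nat b) - bernpoly (n + 1) (x / of_nat a)) / N)"
    "(\<Sum>j<a. F (j * b)) = B ^ n *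
      ((bernpoly (n + 1) (x / of_nat b + of_nat a) - bernpoly (n + 1) (x / of_nat b)) / N)"
    "(\<Sum>r<a * b. F r) =
      (bernpoly (n + 1) (x + of_nat (a * b)) - bernpoly (n + 1) x) / N"
    unfolding F_def A_def B_def N_def
    by (simp_all only: sum_power_arith_progression[OF assms(1)]
      sum_power_arith_progression[OF assms(2)] sum_power_eq_bernpoly Suc_eq_plus1)
  \<comment> \<open>The edge with step \<open>a\<close> carries a factor \<open>A ^ n\<close>, so
    division by \<open>(A * B) ^ n\<close> leaves \<open>B ^ n\<close> in its denominator, and vice
    versa.\<close>
  have alg: "(X - A ^ n * (P / N) - B ^ n * (Q / N) + (R / N + G)) / (A * B) ^ n =
      X / (A * B) ^ n - P / (B ^ n * N) - Q / (A ^ n * N) + R / ((A * B) ^ n * N)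
      + 1 / (A * B) ^ n * G" for X P Q R G :: 'a
    using nz by (simp add: field_simps)
  have "(\<Sum>i=1..b-1. \<Sum>j=1..a-1.
        (x / of_nat (a * b) + of_nat j / of_nat a + of_nat i / of_nat b) ^ n) =
      (\<Sum>i=1..b-1. \<Sum>j=1..a-1. F (i * a + j * b)) / of_nat (a * b) ^ n"
    by (simp only: summand sum_divide_distrib)
  also have "\<dots> = (x ^ n - (\<Sum>i<b. F (i * a)) - (\<Sum>j<a. F (j * b))
      + ((\<Sum>r<a * b. F r) + ?G)) / (A * B) ^ n"
    unfolding sum_box_interior[OF assms(1,2)] sum_box_eq_sum_gaps[OF assms] gaps
    by (simp add: F_def A_def B_def)
  finally show ?thesis
    unfolding rows alg
    by (simp only: A_def B_def N_def of_nat_mult)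
qed

text \<open>The second identity is the first at x = 0. There the term i = n vanishes, both powers
  having exponent 0, so the sum stops before \<open>n\<close>, whereas the English formula lets i
  reach n. The leading \<open>x ^ n\<close> survives only for n = 0, as 1.\<close>

theorem mainTheorem5:
  fixes a b n :: nat
  assumes "a > 0" and "b > 0" and "coprime a b"
  shows
    "(\<forall>x :: 'a :: field_char_0.
        (\<Sum>i=1..b-1. \<Sum>j=1..a-1.
            (x / of_nat (a * b) + of_nat j / of_nat a + of_nat i / of_nat b) ^ n)
        = x ^ n / of_nat (a * b) ^ n
          - (bernpoly (n + 1) (x / of_nat a + of_nat b) - bernpoly (n + 1) (x / of_nat a))
              / (of_nat b ^ n * of_nat (n + 1))
          - (bernpoly (n + 1) (x / of_nat b + of_nat a) - bernpoly (n + 1) (x / of_nat b))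
              / (of_nat a ^ n * of_nat (n + 1))
          + (bernpoly (n + 1) (x + of_nat (a * b)) - bernpoly (n + 1) x)
              / (of_nat (a * b) ^ n * of_nat (n + 1))
          + 1 / of_nat (a * b) ^ n *
              (\<Sum>i=0..n. of_nat (n choose i)
                 * ((x + of_nat (a * b)) ^ (n - i) - x ^ (n - i))
                 * of_nat (sylvester_sum a b i)))
     \<and>
     (\<Sum>i=1..b-1. \<Sum>j=1..a-1. (of_nat j / of_nat a + of_nat i / of_nat b :: 'a) ^ n)
        = (if n = 0 then 1 else 0)
          + (\<Sum>i<n. of_nat (n choose i) * (of_nat (sylvester_sum a b i) / of_nat (a * b) ^ i))
          + 1 / of_nat (n + 1) *
              (bernpoly (n + 1) (of_nat (a * b)) / of_nat (a * b) ^ n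
               - bernpoly (n + 1) (of_nat a) / of_nat a ^ n
               - bernpoly (n + 1) (of_nat b) / of_nat b ^ n
               - of_rat (bernoulli (n + 1))
                   * (1 / of_nat (a * b) ^ n - 1 / of_nat a ^ n - 1 / of_nat b ^ n))"
proof (intro conjI allI)
  fix x :: 'a
  show "(\<Sum>i=1..b-1. \<Sum>j=1..a-1.
        (x / of_nat (a * b) + of_nat j / of_nat a + of_nat i / of_nat b) ^ n)
    = x ^ n / of_nat (a * b) ^ n
      - (bernpoly (n + 1) (x / of_nat a + of_nat b) - bernpoly (n + 1) (x / of_nat a))
          / (of_nat b ^ n * of_nat (n + 1))
      - (bernpoly (n + 1) (x / of_nat b + of_nat a) - bernpoly (n + 1) (x / of_nat b))
          / (of_nat a ^ n * of_nat (n + 1))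
      + (bernpoly (n + 1) (x + of_nat (a * b)) - bernpoly (n + 1) x)
          / (of_nat (a * b) ^ n * of_nat (n + 1))
      + 1 / of_nat (a * b) ^ n *
          (\<Sum>i=0..n. of_nat (n choose i)
             * ((x + of_nat (a * b)) ^ (n - i) - x ^ (n - i))
             * of_nat (sylvester_sum a b i))"
    by (rule sum_shifted_box_power[OF assms])
next
  define M :: 'a where "M = of_nat (a * b)"
  have M: "M \<noteq> 0"
    using assms by (simp add: M_def)
  have "(\<Sum>i=0..n. of_nat (n choose i) * ((0 + M) ^ (n - i) - 0 ^ (n - i))
        * of_nat (sylvester_sum a b i)) =
      (\<Sum>i<n. of_nat (n choose i) * M ^ (n - i) * of_nat (sylvester_sum a b i))"
    by (simp add: atLeast0AtMost lessThan_Suc_atMost[symmetric] power_0_left)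
  also have "1 / M ^ n * \<dots> =
      (\<Sum>i<n. of_nat (n choose i) * (of_nat (sylvester_sum a b i) / M ^ i))"
    unfolding sum_distrib_left
    using M by (intro sum.cong refl) (simp add: power_diff)
  finally have gaps: "1 / M ^ n * (\<Sum>i=0..n. of_nat (n choose i) *
        ((0 + M) ^ (n - i) - 0 ^ (n - i)) * of_nat (sylvester_sum a b i)) =
      (\<Sum>i<n. of_nat (n choose i) * (of_nat (sylvester_sum a b i) / M ^ i))" .
  have zero: "(0 :: 'a) ^ n / M ^ n = (if n = 0 then 1 else 0)"
    by simp
  \<comment> \<open>\<open>\<beta>\<close> stands for the value of \<open>bernpoly (n + 1)\<close>
    at 0, the Bernoulli number shared by all three differences.\<close>
  have alg: "Z - (P - \<beta>) / (V * N) - (Q - \<beta>) / (U * N) + (R - \<beta>) / (W * N) + G =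
      Z + G + 1 / N * (R / W - Q / U - P / V - \<beta> * (1 / W - 1 / U - 1 / V))"
    for Z P Q R G U V W N \<beta> :: 'a
    by (simp add: diff_divide_distrib add_divide_distrib algebra_simps)
  show "(\<Sum>i=1..b-1. \<Sum>j=1..a-1. (of_nat j / of_nat a + of_nat i / of_nat b :: 'a) ^ n)
        = (if n = 0 then 1 else 0)
          + (\<Sum>i<n. of_nat (n choose i) * (of_nat (sylvester_sum a b i) / of_nat (a * b) ^ i))
          + 1 / of_nat (n + 1) *
              (bernpoly (n + 1) (of_nat (a * b)) / of_nat (a * b) ^ n
               - bernpoly (n + 1) (of_nat a) / of_nat a ^ n
               - bernpoly (n + 1) (of_nat b) / of_nat b ^ n
               - of_rat (bernoulli (n + 1))
                   * (1 / of_nat (a * b) ^ n - 1 / of_nat a ^ n - 1 / of_nat b ^ n))"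
    using sum_shifted_box_power[OF assms, of "0 :: 'a" n]
    unfolding M_def[symmetric] gaps zero
    by (simp only: div_0 add_0 bernpoly_0_right alg)
qed

end
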